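(* For any graph $G$, $$\alpha_q(G)\le\lfloor\vartheta^{\mathcal{CS}_+}(G)\rfloor\le\lfloor\vartheta^{\mathrm{cl}(\mathcal{CS}_+)}(G)\rfloor\le\lfloor\vartheta'(G)\rfloor.$$
   Context: Graphs are finite, undirected, without loops, with at least one vertex; $[t]=\{1,\dots,t\}$; $u\simeq v$ means $u=v$ or $u,v$ adjacent. $\mathcal S^d$ denotes the real symmetric $d\times d$ matrices with trace inner product $\langle X,Y\rangle=\mathrm{Tr}(XY)$, and $\mathcal S^d_+$ the positive semidefinite ones; $J$ is the all-ones matrix. $\mathcal{CS}_+^n$ is the set of $A\in\mathcal S^n$ for which there exist $d\ge1$ and $X_1,\dots,X_n\in\mathcal S^d_+$ with $A_{ij}=\langle X_i,X_j\rangle$ for all $i,j$; $\mathrm{cl}(\mathcal{CS}_+)$ is its closure (for each size). $\mathcal{DNN}^n$ is the cone of positive semidefinite matrices in $\mathcal S^n$ with nonnegative entries. $\alpha_q(G)$ is the maximum $t\in\mathbb N$ for which there exist $d\ge1$ and $\rho,\rho_i^u\in\mathcal S^d_+$ ($i\in[t]$, $u\in V(G)$) with $\langle\rho,\rho\rangle=1$; $\sum_{u\in V(G)}\rho_i^u=\rho$ for all $i\in[t]$; $\langle\rho_i^u,\rho_j^v\rangle=0$ for all $i\ne j\in[t]$, $u\simeq v\in V(G)$; $\langle\rho_i^u,\rho_i^v\rangle=0$ for all $i\in[t]$, $u\ne v\in V(G)$. For a cone $\mathcal K$ and $n=|V(G)|$, $\vartheta^{\mathcal K}(G)=\sup\{\langle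 J,X\rangle: X\in\mathcal K^n,\ \mathrm{Tr}(X)=1,\ X_{uv}=0\ \forall\{u,v\}\in E(G)\}$, and $\vartheta'(G)=\vartheta^{\mathcal{DNN}}(G)$. *)

theory Defs
  imports "HOL-Analysis.Analysis" "Jordan_Normal_Form.Matrix"
begin

text \<open>
  Matrices indexed by the vertices of a graph are of type \<open>real ^ 'v ^ 'v\<close>, which carries the
  topology needed for closures.  The matrices of the existentially quantified size \<open>d\<close> are of
  type \<open>real mat\<close>, with the size given by \<open>carrier_mat d d\<close>.
\<close>

no_notation vec_index (infixl \<open>$\<close> 100)

section \<open>Matrices of variable size\<close>

definition psd_mats :: "nat \<Rightarrow> real mat set" where
  "psd_mats d = {X \<in> carrier_mat d d.
     transpose_mat X = X \<and> (\<forall>x \<in> carrier_vec d. scalar_prod x (X *\<^sub>v x) \<ge> 0)}"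

definition mat_trace :: "real mat \<Rightarrow> real" where
  "mat_trace X = (\<Sum>a<dim_row X. X $$ (a, a))"

definition mat_inner :: "real mat \<Rightarrow> real mat \<Rightarrow> real" where
  "mat_inner X Y = mat_trace (X * Y)"

section \<open>Matrix cones\<close>

definition cs_plus :: "(real ^ 'n ^ 'n) set" where
  "cs_plus = {A. Finite_Cartesian_Product.transpose A = A \<and>
     (\<exists>d\<ge>1. \<exists>X :: 'n \<Rightarrow> real mat. (\<forall>i. X i \<in> psd_mats d) \<and>
        (\<forall>i j. A $ i $ j = mat_inner (X i) (X j)))}"

definition dnn :: "(real ^ 'n ^ 'n) set" where
  "dnn = {A. Finite_Cartesian_Product.transpose A = A \<and>
     (\<forall>x :: real ^ 'n. inner x (A *v x) \<ge> 0) \<and> (\<forall>i j. A $ i $ j \<ge> 0)}"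

section \<open>Graph parameters\<close>

text \<open>
  The vertex set is the whole type \<open>'v\<close>, finite and nonempty; \<open>E\<close> is the set of edges.
\<close>

definition simple_graph :: "'v::finite set set \<Rightarrow> bool" where
  "simple_graph E \<longleftrightarrow> (\<forall>e \<in> E. card e = 2)"

definition eq_or_adj :: "'v::finite set set \<Rightarrow> 'v \<Rightarrow> 'v \<Rightarrow> bool" where
  "eq_or_adj E u v \<longleftrightarrow> u = v \<or> {u, v} \<in> E"

definition quantum_independent :: "'v::finite set set \<Rightarrow> nat \<Rightarrow> bool" where
  "quantum_independent E t \<longleftrightarrow>
     (\<exists>d\<ge>1. \<exists>\<rho> :: real mat. \<exists>\<sigma> :: nat \<Rightarrow> 'v \<Rightarrow> real mat.
        \<rho> \<in> psd_mats d \<and> (\<forall>i\<in>{1..t}. \<forall>u. \<sigma> i u \<in> psd_mats d) \<and>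
        mat_inner \<rho> \<rho> = 1 \<and>
        (\<forall>i\<in>{1..t}. (\<Oplus>\<^bsub>module_mat TYPE(real) d d\<^esub>u\<in>UNIV. \<sigma> i u) = \<rho>) \<and>
        (\<forall>i\<in>{1..t}. \<forall>j\<in>{1..t}. \<forall>u v. i \<noteq> j \<longrightarrow> eq_or_adj E u v \<longrightarrow>
           mat_inner (\<sigma> i u) (\<sigma> j v) = 0) \<and>
        (\<forall>i\<in>{1..t}. \<forall>u v. u \<noteq> v \<longrightarrow> mat_inner (\<sigma> i u) (\<sigma> i v) = 0))"

text \<open>\<open>Max\<close> is specified only on finite nonempty sets.  The set below contains 0, and it is
  bounded because \<open>\<alpha>\<^sub>q\<close> never exceeds the number of vertices.\<close>

definition alpha_q :: "'v::finite set set \<Rightarrow> nat" where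
  "alpha_q E = Max {t. quantum_independent E t}"

text \<open>\<open>Sup\<close> on the reals is specified only on nonempty sets that are bounded above.  For the three
  cones used, the set below is such a set: the feasible matrices are positive semidefinite of trace
  1, so their entries sum to at most the number of vertices.\<close>

definition theta_cone :: "(real ^ 'v ^ 'v) set \<Rightarrow> 'v::finite set set \<Rightarrow> real" where
  "theta_cone K E = Sup {Determinants.trace ((\<chi> i j. 1) ** X) | X :: real ^ 'v ^ 'v.
     X \<in> K \<and> Determinants.trace X = 1 \<and> (\<forall>u v. {u, v} \<in> E \<longrightarrow> X $ u $ v = 0)}"

definition theta_prime :: "'v::finite set set \<Rightarrow> real" where
  "theta_prime E = theta_cone dnn E"

end

theory Submission
  imports Defs
begin

text \<open>
  From a quantum independent family \<open>\<rho>\<^sub>i\<^sup>u\<close> with \<open>i \<in> {1..t}\<close>, put \<open>X\<^sub>u = t powr (- 1/2) * (\<Sum>i. \<rho>\<^sub>i\<^sup>u)\<close>.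
  The orthogonality relations make the Gram matrix of the \<open>X\<^sub>u\<close> vanish on the edges and give it
  trace \<open>1\<close>, while \<open>\<Sum>u. \<rho>\<^sub>i\<^sup>u = \<rho>\<close> gives it entry sum \<open>t\<close>; so \<open>t\<close> is one of the values whose supremum is
  the theta number of the completely positive semidefinite cone.  The other two inequalities are
  monotonicity in the cone: the doubly nonnegative cone is closed, and it contains all Gram matrices
  of positive semidefinite matrices because \<open>\<langle>X, Y\<rangle> \<ge> 0\<close> for positive semidefinite \<open>X\<close> and \<open>Y\<close>.
\<close>

section \<open>Positive semidefinite forms on finite index sets\<close>

text \<open>Indexing by a set rather than by a dimension lets an induction remove one index at a
  time. Values of \<open>x\<close> outside \<open>I\<close> do not enter.\<close>

definition psd_form :: "'a set \<Rightarrow> ('a \<Rightarrow> 'a \<Rightarrow> real) \<Rightarrow> bool" where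
  "psd_form I A \<longleftrightarrow> (\<forall>a\<in>I. \<forall>b\<in>I. A a b = A b a) \<and>
     (\<forall>x. (\<Sum>a\<in>I. \<Sum>b\<in>I. x a * x b * A a b) \<ge> 0)"

text \<open>The form is evaluated at \<open>x\<close> extended by the value \<open>c\<close> at
  \<open>z\<close>. As a quadratic polynomial in \<open>c\<close> it yields the restriction to
  \<open>I\<close> at \<open>c = 0\<close> and, at its minimiser, the Schur complement.\<close>

lemma psd_form_insert:
  assumes "finite I" "z \<notin> I" "psd_form (insert z I) A"
  shows "0 \<le> c\<^sup>2 * A z z + 2 * c * (\<Sum>a\<in>I. x a * A a z) + (\<Sum>a\<in>I. \<Sum>b\<in>I. x a * x b * A a b)"
proof -
  define y where "y = x(z := c)"
  have sym: "A z b = A b z" if "b \<in> I" for b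
    using assms(3) that unfolding psd_form_def by blast
  have y: "y z = c" "\<And>a. a \<in> I \<Longrightarrow> y a = x a"
    using assms(2) by (auto simp: y_def)
  have 1: "(\<Sum>b\<in>I. y z * y b * A z b) = c * (\<Sum>a\<in>I. x a * A a z)"
    unfolding sum_distrib_left by (rule sum.cong) (simp_all add: y sym)
  have 2: "(\<Sum>a\<in>I. y a * y z * A a z) = c * (\<Sum>a\<in>I. x a * A a z)"
    unfolding sum_distrib_left by (rule sum.cong) (simp_all add: y)
  have 3: "(\<Sum>a\<in>I. \<Sum>b\<in>I. y a * y b * A a b) = (\<Sum>a\<in>I. \<Sum>b\<in>I. x a * x b * A a b)"
    by (intro sum.cong) (simp_all add: y)
  have "0 \<le> (\<Sum>a\<in>insert z I. \<Sum>b\<in>insert z I. y a * y b * A a b)"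
    using assms(3) unfolding psd_form_def by blast
  also have "\<dots> = c\<^sup>2 * A z z + 2 * c * (\<Sum>a\<in>I. x a * A a z) + (\<Sum>a\<in>I. \<Sum>b\<in>I. x a * x b * A a b)"
    using assms(1,2) 1 2 3 by (simp add: sum.distrib y(1) power2_eq_square)
  finally show ?thesis .
qed

lemma psd_form_mono:
  assumes "finite I" "z \<notin> I" "psd_form (insert z I) A"
  shows "psd_form I A"
  using psd_form_insert[OF assms, of 0] assms(3) by (simp add: psd_form_def)

text \<open>When \<open>A z z = 0\<close> the polynomial in \<open>c\<close> is affine, and an
  affine function bounded below has slope zero.\<close>

lemma psd_form_zero_diag:
  assumes "finite I" "z \<notin> I" "psd_form (insert z I) A" "A z z = 0" "a \<in> I"
  shows "A a z = 0"
proof (rule ccontr)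
  assume nz: "A a z \<noteq> 0"
  define x where "x b = (if b = a then 1 else 0 :: real)" for b
  have "(\<Sum>b\<in>I. x b * A b z) = A a z"
    using assms(1,5) by (simp add: x_def if_distrib[of "\<lambda>t. t * _"] cong: if_cong)
  then have "0 \<le> 2 * c * A a z + (\<Sum>a\<in>I. \<Sum>b\<in>I. x a * x b * A a b)" for c
    using psd_form_insert[OF assms(1-3), of c x] assms(4) by simp
  \<comment> \<open>This \<open>c\<close> gives the affine expression the value -1.\<close>
  from this[of "- ((\<Sum>a\<in>I. \<Sum>b\<in>I. x a * x b * A a b) + 1) / (2 * A a z)"]
  show False using nz by (simp add: field_simps)
qed

text \<open>Peeling off one index at a time by its Schur complement amounts to a Cholesky decomposition of
  \<open>A\<close>, so no spectral theorem is needed.\<close>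

lemma psd_form_sum_mult_nonneg:
  assumes "finite I" "psd_form I A" "psd_form I B"
  shows "0 \<le> (\<Sum>a\<in>I. \<Sum>b\<in>I. A a b * B a b)"
  using assms
proof (induction I arbitrary: A rule: finite_induct)
  case (insert z I)
  \<comment> \<open>\<open>A'\<close> is the Schur complement of the entry at \<open>z\<close>, and
    \<open>v\<close> is the Cholesky column split off. If \<open>A z z = 0\<close>, division by zero
    gives \<open>A' = A\<close> and \<open>v = 0\<close>, so the decomposition below needs no case
    split.\<close>
  define A' where "A' a b = A a b - A a z * A b z / A z z" for a b
  define v where "v a = A a z / sqrt (A z z)" for a
  have sym: "A a b = A b a" if "a \<in> insert z I" "b \<in> insert z I" for a b
    using insert.prems(1) that by (auto simp: psd_form_def)
  have Azz: "A z z \<ge> 0"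
    using psd_form_insert[OF insert.hyps insert.prems(1), of 1 "\<lambda>_. 0"] by simp
  \<comment> \<open>For \<open>A z z = 0\<close> this is the vanishing of the whole column;
    otherwise the two terms cancel.\<close>
  have A'z: "A' a z = 0" "A' z a = 0" if "a \<in> insert z I" for a
    using psd_form_zero_diag[OF insert.hyps insert.prems(1), of a] that sym[of a z]
    by (auto simp: A'_def)
  have A: "A a b = A' a b + v a * v b" for a b
    using Azz by (simp add: A'_def v_def real_sqrt_mult[symmetric])
  have "psd_form I A'"
    unfolding psd_form_def
  proof (intro conjI ballI allI)
    fix a b assume "a \<in> I" "b \<in> I"
    then show "A' a b = A' b a" using sym[of a b] by (simp add: A'_def mult.commute)
  next
    fix x :: "'a \<Rightarrow> real"
    let ?s = "\<Sum>a\<in>I. x a * A a z"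
    have "(\<Sum>a\<in>I. \<Sum>b\<in>I. x a * x b * (A a z * A b z / A z z)) = ?s * ?s / A z z"
      unfolding sum_product sum_divide_distrib by (simp add: mult_ac)
    then have "(\<Sum>a\<in>I. \<Sum>b\<in>I. x a * x b * A' a b) =
        (\<Sum>a\<in>I. \<Sum>b\<in>I. x a * x b * A a b) - ?s * ?s / A z z"
      by (simp add: A'_def right_diff_distrib sum_subtractf)
    \<comment> \<open>Completing the square: the form of \<open>A'\<close> is the minimum over
      \<open>c\<close> of the extended form of \<open>A\<close>, attained at
      \<open>c = - ?s / A z z\<close>.\<close>
    also have "\<dots> = (- ?s / A z z)\<^sup>2 * A z z + 2 * (- ?s / A z z) * ?s
        + (\<Sum>a\<in>I. \<Sum>b\<in>I. x a * x b * A a b)"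
      by (cases "A z z = 0") (simp_all add: field_simps power2_eq_square)
    also have "\<dots> \<ge> 0"
      by (rule psd_form_insert[OF insert.hyps insert.prems(1)])
    finally show "0 \<le> (\<Sum>a\<in>I. \<Sum>b\<in>I. x a * x b * A' a b)" .
  qed
  then have "0 \<le> (\<Sum>a\<in>I. \<Sum>b\<in>I. A' a b * B a b)"
    using insert.IH psd_form_mono[OF insert.hyps insert.prems(2)] by blast
  also have "\<dots> = (\<Sum>a\<in>insert z I. \<Sum>b\<in>insert z I. A' a b * B a b)"
    using insert.hyps A'z by simp
  \<comment> \<open>The added rank-one part is the quadratic form of \<open>B\<close> at
    \<open>v\<close>.\<close>
  also have "\<dots> \<le> \<dots> + (\<Sum>a\<in>insert z I. \<Sum>b\<in>insert z I. v a * v b * B a b)"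
    using insert.prems(2) unfolding psd_form_def by simp
  also have "\<dots> = (\<Sum>a\<in>insert z I. \<Sum>b\<in>insert z I. A a b * B a b)"
    unfolding A by (simp only: distrib_right sum.distrib)
  finally show ?case .
qed simp

section \<open>The trace inner product\<close>

lemma psd_mats_iff:
  "X \<in> psd_mats d \<longleftrightarrow> X \<in> carrier_mat d d \<and> psd_form {..<d} (\<lambda>a b. X $$ (a, b))"
proof (cases "X \<in> carrier_mat d d")
  case True
  have quad: "scalar_prod (Matrix.vec d x) (X *\<^sub>v Matrix.vec d x) =
      (\<Sum>a<d. \<Sum>b<d. x a * x b * X $$ (a, b))" for x
    using True by (simp add: scalar_prod_def sum_distrib_left mult_ac lessThan_atLeast0)
  have "(\<forall>x\<in>carrier_vec d. scalar_prod x (X *\<^sub>v x) \<ge> 0) \<longleftrightarrow>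
      (\<forall>x. scalar_prod (Matrix.vec d x) (X *\<^sub>v Matrix.vec d x) \<ge> 0)"
    by (metis carrier_vecD dim_vec eq_vecI index_vec vec_carrier)
  moreover have "transpose_mat X = X \<longleftrightarrow> (\<forall>a<d. \<forall>b<d. X $$ (a, b) = X $$ (b, a))"
    using True by (auto simp: mat_eq_iff)
  ultimately show ?thesis
    using True by (simp add: psd_mats_def psd_form_def quad Ball_def)
qed (simp add: psd_mats_def)

lemma psd_mats_carrier: "X \<in> psd_mats d \<Longrightarrow> X \<in> carrier_mat d d"
  by (simp add: psd_mats_iff)

lemma mat_inner_eq:
  assumes "X \<in> carrier_mat d d" "Y \<in> carrier_mat d d"
  shows "mat_inner X Y = (\<Sum>a<d. \<Sum>b<d. X $$ (a, b) * Y $$ (b, a))"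
  using assms by (simp add: mat_inner_def mat_trace_def scalar_prod_def lessThan_atLeast0)

text \<open>Symmetry of \<open>Y\<close> turns the trace of the product into the sum of entrywise
  products, where the Cholesky argument applies.\<close>

lemma mat_inner_nonneg:
  assumes "X \<in> psd_mats d" "Y \<in> psd_mats d"
  shows "0 \<le> mat_inner X Y"
proof -
  have "mat_inner X Y = (\<Sum>a<d. \<Sum>b<d. X $$ (a, b) * Y $$ (a, b))"
    using assms by (auto simp: mat_inner_eq[of _ d] psd_mats_iff psd_form_def intro!: sum.cong)
  also have "\<dots> \<ge> 0"
    by (rule psd_form_sum_mult_nonneg) (use assms in \<open>simp_all add: psd_mats_iff\<close>)
  finally show ?thesis .
qed

lemma mat_inner_commute:
  assumes "X \<in> carrier_mat d d" "Y \<in> carrier_mat d d"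
  shows "mat_inner X Y = mat_inner Y X"
  unfolding mat_inner_eq[OF assms] mat_inner_eq[OF assms(2,1)]
  by (subst sum.swap) (simp add: mult.commute)

text \<open>With the size as an explicit argument, every combination lies in
  \<open>carrier_mat d d\<close> without side conditions, and the empty one is the zero matrix of
  that size.\<close>

definition mat_comb :: "nat \<Rightarrow> 'i set \<Rightarrow> ('i \<Rightarrow> real) \<Rightarrow> ('i \<Rightarrow> real mat) \<Rightarrow> real mat" where
  "mat_comb d I c X = Matrix.mat d d (\<lambda>p. \<Sum>i\<in>I. c i * X i $$ p)"

lemma mat_comb_carrier [simp]: "mat_comb d I c X \<in> carrier_mat d d"
  by (simp add: mat_comb_def)

lemma mat_comb_index:
  "a < d \<Longrightarrow> b < d \<Longrightarrow> mat_comb d I c X $$ (a, b) = (\<Sum>i\<in>I. c i * X i $$ (a, b))"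
  by (simp add: mat_comb_def)

lemma mat_inner_comb:
  assumes "\<And>i. i \<in> I \<Longrightarrow> X i \<in> carrier_mat d d" "\<And>j. j \<in> J \<Longrightarrow> Y j \<in> carrier_mat d d"
  shows "mat_inner (mat_comb d I c X) (mat_comb d J e Y) =
    (\<Sum>i\<in>I. \<Sum>j\<in>J. c i * e j * mat_inner (X i) (Y j))"
proof -
  let ?g = "\<lambda>i j a b. c i * e j * (X i $$ (a, b) * Y j $$ (b, a))"
  have "mat_inner (mat_comb d I c X) (mat_comb d J e Y) = (\<Sum>a<d. \<Sum>b<d. \<Sum>i\<in>I. \<Sum>j\<in>J. ?g i j a b)"
    by (simp add: mat_inner_eq[of _ d] mat_comb_index sum_product mult_ac)
  also have "\<dots> = (\<Sum>i\<in>I. \<Sum>a<d. \<Sum>b<d. \<Sum>j\<in>J. ?g i j a b)"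
    by (simp only: sum.swap[of _ I])
  also have "\<dots> = (\<Sum>i\<in>I. \<Sum>j\<in>J. \<Sum>a<d. \<Sum>b<d. ?g i j a b)"
    by (simp only: sum.swap[of _ J])
  also have "\<dots> = (\<Sum>i\<in>I. \<Sum>j\<in>J. c i * e j * mat_inner (X i) (Y j))"
    by (intro sum.cong) (simp_all add: mat_inner_eq[of _ d] assms sum_distrib_left)
  finally show ?thesis .
qed

lemma mat_comb_psd:
  assumes "\<And>i. i \<in> I \<Longrightarrow> X i \<in> psd_mats d" "\<And>i. i \<in> I \<Longrightarrow> c i \<ge> 0"
  shows "mat_comb d I c X \<in> psd_mats d"
proof -
  have "0 \<le> (\<Sum>a<d. \<Sum>b<d. x a * x b * mat_comb d I c X $$ (a, b))" for x
  proof -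
    have "(\<Sum>a<d. \<Sum>b<d. x a * x b * mat_comb d I c X $$ (a, b)) =
        (\<Sum>a<d. \<Sum>b<d. \<Sum>i\<in>I. c i * (x a * x b * X i $$ (a, b)))"
      by (simp add: mat_comb_index sum_distrib_left mult_ac)
    also have "\<dots> = (\<Sum>i\<in>I. c i * (\<Sum>a<d. \<Sum>b<d. x a * x b * X i $$ (a, b)))"
      by (simp only: sum.swap[of _ I] sum_distrib_left)
    also have "\<dots> \<ge> 0"
    proof (rule sum_nonneg, rule mult_nonneg_nonneg)
      fix i assume "i \<in> I"
      then show "0 \<le> c i" "0 \<le> (\<Sum>a<d. \<Sum>b<d. x a * x b * X i $$ (a, b))"
        using assms by (auto simp: psd_mats_iff psd_form_def)
    qed
    finally show ?thesis .
  qed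
  then show ?thesis
    using assms(1) by (auto simp: psd_mats_iff psd_form_def mat_comb_index intro!: sum.cong)
qed

text \<open>The coefficients may have any sign: the combination is still symmetric, so this is its
  squared Frobenius norm.\<close>

lemma mat_comb_inner_self_nonneg:
  assumes "\<And>i. i \<in> I \<Longrightarrow> X i \<in> psd_mats d"
  shows "0 \<le> mat_inner (mat_comb d I c X) (mat_comb d I c X)"
proof -
  let ?Z = "mat_comb d I c X"
  have "?Z $$ (b, a) = ?Z $$ (a, b)" if "a < d" "b < d" for a b
    using assms that by (auto simp: psd_mats_iff psd_form_def mat_comb_index intro!: sum.cong)
  then have "mat_inner ?Z ?Z = (\<Sum>a<d. \<Sum>b<d. (?Z $$ (a, b))\<^sup>2)"
    by (simp add: mat_inner_eq[of _ d] power2_eq_square)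
  also have "\<dots> \<ge> 0"
    by (intro sum_nonneg) simp
  finally show ?thesis .
qed

text \<open>Translates the module sum in \<open>quantum_independent\<close> into a combination, to
  which bilinearity applies.\<close>

lemma finsum_mat_eq_comb:
  assumes "finite I" "\<And>i. i \<in> I \<Longrightarrow> X i \<in> carrier_mat d d"
  shows "(\<Oplus>\<^bsub>module_mat TYPE(real) d d\<^esub>i\<in>I. X i) = mat_comb d I (\<lambda>_. 1) X"
  using assms
proof (induction I rule: finite_induct)
  case empty
  interpret abelian_group "module_mat TYPE(real) d d" by (rule abelian_group_mat)
  show ?case by (auto simp: mat_comb_def module_mat_simps)
next
  case (insert i I)
  interpret abelian_group "module_mat TYPE(real) d d" by (rule abelian_group_mat)
  have "(\<Oplus>\<^bsub>module_mat TYPE(real) d d\<^esub>i\<in>insert i I. X i) =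
      X i + (\<Oplus>\<^bsub>module_mat TYPE(real) d d\<^esub>i\<in>I. X i)"
    using insert.hyps insert.prems by (subst finsum_insert) (auto simp: module_mat_simps)
  then show ?case
    using insert by (intro eq_matI) (auto simp: mat_comb_def)
qed

section \<open>Cones\<close>

lemma dnn_iff:
  "A \<in> dnn \<longleftrightarrow> (\<forall>i j. A $ i $ j = A $ j $ i) \<and>
    (\<forall>x::real^'n. 0 \<le> (\<Sum>i\<in>UNIV. \<Sum>j\<in>UNIV. x $ i * x $ j * A $ i $ j)) \<and> (\<forall>i j. A $ i $ j \<ge> 0)"
  for A :: "real ^ 'n ^ 'n"
proof -
  have "inner x (A *v x) = (\<Sum>i\<in>UNIV. \<Sum>j\<in>UNIV. x $ i * x $ j * A $ i $ j)" for x
    by (simp add: inner_vec_def matrix_vector_mult_def sum_distrib_left mult_ac)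
  moreover have "Finite_Cartesian_Product.transpose A = A \<longleftrightarrow> (\<forall>i j. A $ i $ j = A $ j $ i)"
    by (simp add: Finite_Cartesian_Product.transpose_def Finite_Cartesian_Product.vec_eq_iff) metis
  ultimately show ?thesis
    by (simp add: dnn_def)
qed

text \<open>For each fixed \<open>x\<close> and each index pair the condition is an equation or a
  non-strict inequality between continuous functions of \<open>A\<close>.\<close>

lemma closed_dnn: "closed (dnn :: (real ^ 'n ^ 'n) set)"
proof -
  have "dnn = {A :: real ^ 'n ^ 'n. (\<forall>i j. A $ i $ j = A $ j $ i) \<and>
    (\<forall>x::real^'n. 0 \<le> (\<Sum>i\<in>UNIV. \<Sum>j\<in>UNIV. x $ i * x $ j * A $ i $ j)) \<and> (\<forall>i j. A $ i $ j \<ge> 0)}"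
    unfolding set_eq_iff mem_Collect_eq by (intro allI dnn_iff)
  also have "closed \<dots>"
    by (intro closed_Collect_conj closed_Collect_all closed_Collect_eq closed_Collect_le continuous_intros)
  finally show ?thesis .
qed

text \<open>The form of a Gram matrix at \<open>x\<close> is the squared norm of the combination of
  the \<open>X i\<close> with coefficients \<open>x $ i\<close>.\<close>

lemma cs_plus_subset_dnn: "cs_plus \<subseteq> (dnn :: (real ^ 'n ^ 'n) set)"
proof
  fix A :: "real ^ 'n ^ 'n" assume "A \<in> cs_plus"
  then obtain d and X :: "'n \<Rightarrow> real mat" where X: "\<And>i. X i \<in> psd_mats d"
    and A: "\<And>i j. A $ i $ j = mat_inner (X i) (X j)"
    by (auto simp: cs_plus_def)
  note carr = psd_mats_carrier[OF X]
  have "(\<Sum>i\<in>UNIV. \<Sum>j\<in>UNIV. x $ i * x $ j * A $ i $ j) =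
      mat_inner (mat_comb d UNIV (($) x) X) (mat_comb d UNIV (($) x) X)" for x
    by (simp add: mat_inner_comb carr A)
  then show "A \<in> dnn"
    by (simp add: dnn_iff mat_comb_inner_self_nonneg X)
      (simp add: A mat_inner_nonneg[OF X X] mat_inner_commute[OF carr carr])
qed

lemma gram_in_cs_plus:
  fixes X :: "'n::finite \<Rightarrow> real mat"
  assumes "d \<ge> 1" "\<And>i. X i \<in> psd_mats d"
  shows "(\<chi> i j. mat_inner (X i) (X j)) \<in> cs_plus"
proof -
  note carr = psd_mats_carrier[OF assms(2)]
  have "Finite_Cartesian_Product.transpose (\<chi> i j. mat_inner (X i) (X j)) = (\<chi> i j. mat_inner (X i) (X j))"
    by (simp add: Finite_Cartesian_Product.transpose_def Finite_Cartesian_Product.vec_eq_iff)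
      (metis mat_inner_commute carr)
  then show ?thesis
    using assms unfolding cs_plus_def by fastforce
qed

section \<open>Theta numbers\<close>

definition theta_values :: "(real ^ 'v ^ 'v) set \<Rightarrow> 'v::finite set set \<Rightarrow> real set" where
  "theta_values K E = {Determinants.trace ((\<chi> i j. 1) ** X) | X :: real ^ 'v ^ 'v.
     X \<in> K \<and> Determinants.trace X = 1 \<and> (\<forall>u v. {u, v} \<in> E \<longrightarrow> X $ u $ v = 0)}"

lemma theta_cone_eq_Sup: "theta_cone K E = Sup (theta_values K E)"
  by (simp add: theta_cone_def theta_values_def)

lemma theta_values_mono: "K \<subseteq> L \<Longrightarrow> theta_values K E \<subseteq> theta_values L E"
  by (auto simp: theta_values_def)

lemma trace_ones_mult:
  "Determinants.trace ((\<chi> i j. 1) ** X) = (\<Sum>u\<in>UNIV. \<Sum>v\<in>UNIV. X $ u $ v)"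
  for X :: "real ^ 'v ^ 'v"
  unfolding Determinants.trace_def matrix_matrix_mult_def by (subst sum.swap) simp

text \<open>Testing the form on the difference of two unit vectors bounds
  \<open>2 * X $ u $ v\<close> by \<open>X $ u $ u + X $ v $ v\<close>; summing over all pairs gives
  the trace bound. It makes the suprema finite.\<close>

lemma dnn_sum_le:
  fixes X :: "real ^ 'v ^ 'v"
  assumes "X \<in> dnn"
  shows "(\<Sum>u\<in>UNIV. \<Sum>v\<in>UNIV. X $ u $ v) \<le> CARD('v) * Determinants.trace X"
proof -
  have le: "2 * X $ u $ v \<le> X $ u $ u + X $ v $ v" for u v
  proof (cases "u = v")
    case False
    define x :: "real ^ 'v" where "x = (\<chi> w. if w = u then 1 else if w = v then - 1 else 0)"
    have s: "(\<Sum>w\<in>UNIV. x $ w * f w) = f u - f v" for f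
    proof -
      have "(\<Sum>w\<in>UNIV. x $ w * f w) = (\<Sum>w\<in>{u, v}. x $ w * f w)"
        by (rule sum.mono_neutral_right) (auto simp: x_def)
      then show ?thesis using False by (simp add: x_def)
    qed
    have "0 \<le> (\<Sum>i\<in>UNIV. \<Sum>j\<in>UNIV. x $ i * x $ j * X $ i $ j)"
      using assms unfolding dnn_iff by blast
    also have "\<dots> = (\<Sum>i\<in>UNIV. x $ i * (\<Sum>j\<in>UNIV. x $ j * X $ i $ j))"
      by (simp add: sum_distrib_left mult_ac)
    also have "\<dots> = X $ u $ u - X $ u $ v - (X $ v $ u - X $ v $ v)"
      by (simp add: s)
    finally show ?thesis using assms unfolding dnn_iff by (smt (verit))
  qed simp
  have "2 * (\<Sum>u\<in>UNIV. \<Sum>v\<in>UNIV. X $ u $ v) \<le> (\<Sum>u\<in>UNIV. \<Sum>v\<in>UNIV. X $ u $ u + X $ v $ v)"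
    unfolding sum_distrib_left by (intro sum_mono le)
  also have "\<dots> = 2 * (CARD('v) * Determinants.trace X)"
    by (simp add: sum.distrib Determinants.trace_def sum_distrib_left)
  finally show ?thesis by simp
qed

lemma bdd_above_theta_values:
  assumes "K \<subseteq> dnn"
  shows "bdd_above (theta_values K (E :: 'v::finite set set))"
proof (rule bdd_aboveI)
  fix r assume "r \<in> theta_values K E"
  then show "r \<le> CARD('v)"
    using assms dnn_sum_le by (fastforce simp: theta_values_def trace_ones_mult)
qed

text \<open>Comparing real suprema requires the smaller set to be nonempty and the larger one
  bounded above, the latter coming from \<open>L \<subseteq> dnn\<close>.\<close>

lemma theta_cone_mono:
  assumes "K \<subseteq> L" "L \<subseteq> dnn" "theta_values K E \<noteq> {}"
  shows "theta_cone K E \<le> theta_cone L E"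
  unfolding theta_cone_eq_Sup
  by (intro cSup_subset_mono assms theta_values_mono bdd_above_theta_values)

lemma gram_theta_value:
  fixes X :: "'v::finite \<Rightarrow> real mat"
  assumes "d \<ge> 1" "\<And>u. X u \<in> psd_mats d" "(\<Sum>u\<in>UNIV. mat_inner (X u) (X u)) = 1"
    "\<And>u v. {u, v} \<in> E \<Longrightarrow> mat_inner (X u) (X v) = 0"
  shows "(\<Sum>u\<in>UNIV. \<Sum>v\<in>UNIV. mat_inner (X u) (X v)) \<in> theta_values cs_plus E"
proof -
  let ?A = "\<chi> u v. mat_inner (X u) (X v)"
  have "Determinants.trace ?A = 1"
    using assms(3) by (simp add: Determinants.trace_def)
  moreover have "\<forall>u v. {u, v} \<in> E \<longrightarrow> ?A $ u $ v = 0"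
    using assms(4) by simp
  ultimately have "Determinants.trace ((\<chi> i j. 1) ** ?A) \<in> theta_values cs_plus E"
    using gram_in_cs_plus[of d X, OF assms(1,2)] unfolding theta_values_def by blast
  then show ?thesis by (simp add: trace_ones_mult)
qed

text \<open>The witness is the matrix whose only nonzero entry is a 1 at \<open>(w, w)\<close> for
  an arbitrary vertex \<open>w\<close>. It supplies nonemptiness and covers the case
  \<open>t = 0\<close> later.\<close>

lemma one_in_theta_values:
  assumes "simple_graph E"
  shows "1 \<in> theta_values cs_plus (E :: 'v::finite set set)"
proof -
  fix w :: 'v
  define X where "X u = Matrix.mat 1 1 (\<lambda>_. if u = w then 1 else 0 :: real)" for u
  have psd: "X u \<in> psd_mats 1" for u
    by (auto simp: psd_mats_iff psd_form_def X_def)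
  have inner: "mat_inner (X u) (X v) = (if u = w then if v = w then 1 else 0 else 0)" for u v
    by (subst mat_inner_eq[of _ 1]) (auto simp: X_def)
  \<comment> \<open>A nonzero value would force \<open>u = v = w\<close>, hence a loop.\<close>
  have "mat_inner (X u) (X v) = 0" if "{u, v} \<in> E" for u v
    using assms that by (auto simp: inner simple_graph_def)
  then have "(\<Sum>u\<in>UNIV. \<Sum>v\<in>UNIV. mat_inner (X u) (X v)) \<in> theta_values cs_plus E"
    by (intro gram_theta_value[OF order_refl psd]) (simp_all add: inner)
  moreover have "(\<Sum>v\<in>UNIV. mat_inner (X u) (X v)) = (if u = w then 1 else 0)" for u
    by (simp add: inner)
  ultimately show ?thesis by simp
qed

section \<open>Quantum independent sets\<close>

lemma quantum_independent_theta_value: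
  fixes E :: "'v::finite set set"
  assumes E: "simple_graph E" and "quantum_independent E t" "t \<ge> 1"
  shows "real t \<in> theta_values cs_plus E"
proof -
  from assms(2) obtain d and \<rho> :: "real mat" and \<sigma> :: "nat \<Rightarrow> 'v \<Rightarrow> real mat" where
    d: "d \<ge> 1" and
    unit: "mat_inner \<rho> \<rho> = 1" and
    fam: "\<forall>i\<in>{1..t}. \<forall>u. \<sigma> i u \<in> psd_mats d"
      "\<forall>i\<in>{1..t}. (\<Oplus>\<^bsub>module_mat TYPE(real) d d\<^esub>u\<in>UNIV. \<sigma> i u) = \<rho>"
      "\<forall>i\<in>{1..t}. \<forall>j\<in>{1..t}. \<forall>u v. i \<noteq> j \<longrightarrow> eq_or_adj E u v \<longrightarrow> mat_inner (\<sigma> i u) (\<sigma> j v) = 0"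
      "\<forall>i\<in>{1..t}. \<forall>u v. u \<noteq> v \<longrightarrow> mat_inner (\<sigma> i u) (\<sigma> i v) = 0"
    unfolding quantum_independent_def by (elim exE conjE) (rule that)
  have \<sigma>: "\<sigma> i u \<in> psd_mats d"
    and sum: "(\<Oplus>\<^bsub>module_mat TYPE(real) d d\<^esub>u\<in>UNIV. \<sigma> i u) = \<rho>" if "i \<in> {1..t}" for i u
    using fam(1,2) that by auto
  have orth: "mat_inner (\<sigma> i u) (\<sigma> j v) = 0"
    if "i \<in> {1..t}" "j \<in> {1..t}" "i \<noteq> j" "eq_or_adj E u v" for i j u v
    using fam(3) that by blast
  have orth': "mat_inner (\<sigma> i u) (\<sigma> i v) = 0" if "i \<in> {1..t}" "u \<noteq> v" for i u v
    using fam(4) that by blast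
  note carr = psd_mats_carrier[OF \<sigma>]
  have \<rho>_eq: "\<rho> = mat_comb d UNIV (\<lambda>_. 1) (\<sigma> i)" if "i \<in> {1..t}" for i
    using sum[OF that] finsum_mat_eq_comb[of UNIV "\<sigma> i" d] carr[OF that] by simp
  \<comment> \<open>Each index sums to the same \<open>\<rho>\<close>, so every pair
    \<open>i\<close>, \<open>j\<close> gives \<open>mat_inner \<rho> \<rho>\<close>, also when
    \<open>i \<noteq> j\<close>.\<close>
  have one: "(\<Sum>u\<in>UNIV. \<Sum>v\<in>UNIV. mat_inner (\<sigma> i u) (\<sigma> j v)) = 1" if "i \<in> {1..t}" "j \<in> {1..t}" for i j
  proof -
    have "1 = mat_inner (mat_comb d UNIV (\<lambda>_. 1) (\<sigma> i)) (mat_comb d UNIV (\<lambda>_. 1) (\<sigma> j))"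
      using unit \<rho>_eq[OF that(1)] \<rho>_eq[OF that(2)] by simp
    then show ?thesis using that by (simp add: mat_inner_comb carr)
  qed
  define X where "X u = mat_comb d {1..t} (\<lambda>_. 1 / sqrt t) (\<lambda>i. \<sigma> i u)" for u
  have X: "mat_inner (X u) (X v) = (\<Sum>i\<in>{1..t}. \<Sum>j\<in>{1..t}. mat_inner (\<sigma> i u) (\<sigma> j v)) / t" for u v
    unfolding X_def
    by (subst mat_inner_comb) (simp_all add: carr sum_divide_distrib real_sqrt_mult[symmetric])
  \<comment> \<open>The terms with \<open>j \<noteq> i\<close> vanish, and the terms with
    \<open>v \<noteq> u\<close>, zero as well, are put in their place. Summed over \<open>u\<close>,
    each \<open>i\<close> then contributes 1 by \<open>one\<close>, and division by \<open>t\<close>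
    makes the trace 1.\<close>
  have diag: "mat_inner (X u) (X u) = (\<Sum>i\<in>{1..t}. \<Sum>v\<in>UNIV. mat_inner (\<sigma> i u) (\<sigma> i v)) / t" for u
  proof -
    have "(\<Sum>j\<in>{1..t}. mat_inner (\<sigma> i u) (\<sigma> j u)) = mat_inner (\<sigma> i u) (\<sigma> i u)" if "i \<in> {1..t}" for i
      using that by (subst sum.remove[of _ i]) (auto simp: eq_or_adj_def intro!: sum.neutral orth)
    moreover have "(\<Sum>v\<in>UNIV. mat_inner (\<sigma> i u) (\<sigma> i v)) = mat_inner (\<sigma> i u) (\<sigma> i u)" if "i \<in> {1..t}" for i
      using that by (subst sum.remove[of _ u]) (auto intro!: sum.neutral orth')
    ultimately show ?thesis by (simp add: X)
  qed
  have "(\<Sum>u\<in>UNIV. mat_inner (X u) (X u)) =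
      (\<Sum>i\<in>{1..t}. \<Sum>u\<in>UNIV. \<Sum>v\<in>UNIV. mat_inner (\<sigma> i u) (\<sigma> i v)) / t"
    unfolding diag sum_divide_distrib[symmetric] by (subst sum.swap) simp
  also have "\<dots> = 1" using one assms(3) by simp
  finally have tr: "(\<Sum>u\<in>UNIV. mat_inner (X u) (X u)) = 1" .
  \<comment> \<open>Adjacency handles \<open>i \<noteq> j\<close>, and distinctness of the endpoints
    handles \<open>i = j\<close>.\<close>
  have "mat_inner (X u) (X v) = 0" if "{u, v} \<in> E" for u v
  proof -
    have "u \<noteq> v" using E that by (auto simp: simple_graph_def)
    then have "mat_inner (\<sigma> i u) (\<sigma> j v) = 0" if "i \<in> {1..t}" "j \<in> {1..t}" for i j
      using orth[OF that] orth'[OF that(1)] \<open>{u, v} \<in> E\<close> by (cases "i = j") (auto simp: eq_or_adj_def)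
    then show ?thesis by (simp add: X)
  qed
  moreover have "X u \<in> psd_mats d" for u
    unfolding X_def by (rule mat_comb_psd) (simp_all add: \<sigma>)
  ultimately have "(\<Sum>u\<in>UNIV. \<Sum>v\<in>UNIV. mat_inner (X u) (X v)) \<in> theta_values cs_plus E"
    using d tr by (intro gram_theta_value)
  also have "(\<Sum>u\<in>UNIV. \<Sum>v\<in>UNIV. mat_inner (X u) (X v)) =
      (\<Sum>i\<in>{1..t}. \<Sum>j\<in>{1..t}. \<Sum>u\<in>UNIV. \<Sum>v\<in>UNIV. mat_inner (\<sigma> i u) (\<sigma> j v)) / t"
    unfolding X sum_divide_distrib[symmetric] by (simp only: sum.swap[of _ "{1..t}" UNIV])
  \<comment> \<open>There are \<open>t * t\<close> pairs, each contributing 1, divided by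
    \<open>t\<close>.\<close>
  also have "\<dots> = t" using one assms(3) by simp
  finally show ?thesis .
qed

text \<open>For \<open>t = 0\<close> only a \<open>\<rho>\<close> of norm 1 has to be found; this
  keeps the set under \<open>Max\<close> nonempty.\<close>

lemma quantum_independent_0: "quantum_independent E 0"
proof -
  have "Matrix.mat 1 1 (\<lambda>_. 1) \<in> psd_mats 1"
    by (auto simp: psd_mats_iff psd_form_def)
  moreover have "mat_inner (Matrix.mat 1 1 (\<lambda>_. 1)) (Matrix.mat 1 1 (\<lambda>_. 1)) = 1"
    by (subst mat_inner_eq[of _ 1]) auto
  ultimately show ?thesis
    unfolding quantum_independent_def by (intro exI[of _ 1]) auto
qed

lemma quantum_independent_le_theta:
  assumes "simple_graph E" "quantum_independent E t"
  shows "real t \<le> theta_cone cs_plus E"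
proof (cases "t \<ge> 1")
  case True
  then show ?thesis
    unfolding theta_cone_eq_Sup using assms
    by (intro cSup_upper quantum_independent_theta_value bdd_above_theta_values cs_plus_subset_dnn)
next
  \<comment> \<open>For \<open>t = 0\<close> the scaling by \<open>1 / sqrt t\<close> breaks down,
    so the value 1 is used instead.\<close>
  case False
  have "1 \<le> theta_cone cs_plus E"
    unfolding theta_cone_eq_Sup using assms(1)
    by (intro cSup_upper one_in_theta_values bdd_above_theta_values cs_plus_subset_dnn)
  with False show ?thesis by simp
qed

text \<open>The theta bound makes the set of admissible \<open>t\<close> finite, so
  \<open>Max\<close> is an actual maximum and is attained.\<close>

lemma quantum_independent_alpha_q:
  assumes "simple_graph E"
  shows "quantum_independent E (alpha_q E)"
proof -
  have "t \<le> nat \<lfloor>theta_cone cs_plus E\<rfloor>" if "quantum_independent E t" for t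
    using quantum_independent_le_theta[OF assms that] by (rule le_nat_floor)
  then have "finite {t. quantum_independent E t}"
    unfolding finite_nat_set_iff_bounded_le by blast
  moreover have "{t. quantum_independent E t} \<noteq> {}"
    using quantum_independent_0 by blast
  ultimately show ?thesis
    using Max_in by (auto simp: alpha_q_def)
qed

theorem proposition4p9:
  fixes E :: "'v::finite set set"
  assumes "simple_graph E"
  shows "int (alpha_q E) \<le> \<lfloor>theta_cone cs_plus E\<rfloor> \<and>
         \<lfloor>theta_cone cs_plus E\<rfloor> \<le> \<lfloor>theta_cone (closure cs_plus) E\<rfloor> \<and>
         \<lfloor>theta_cone (closure cs_plus) E\<rfloor> \<le> \<lfloor>theta_prime E\<rfloor>"
proof (intro conjI)
  have cl: "closure cs_plus \<subseteq> (dnn :: (real ^ 'v ^ 'v) set)"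
    by (rule closure_minimal[OF cs_plus_subset_dnn closed_dnn])
  have ne: "theta_values cs_plus E \<noteq> {}"
    using one_in_theta_values[OF assms] by blast
  then have ne': "theta_values (closure cs_plus) E \<noteq> {}"
    using theta_values_mono[OF closure_subset[of cs_plus], of E] by auto
  show "int (alpha_q E) \<le> \<lfloor>theta_cone cs_plus E\<rfloor>"
    using quantum_independent_le_theta[OF assms quantum_independent_alpha_q[OF assms]]
    by (simp add: le_floor_iff)
  show "\<lfloor>theta_cone cs_plus E\<rfloor> \<le> \<lfloor>theta_cone (closure cs_plus) E\<rfloor>"
    by (rule floor_mono[OF theta_cone_mono[OF closure_subset cl ne]])
  show "\<lfloor>theta_cone (closure cs_plus) E\<rfloor> \<le> \<lfloor>theta_prime E\<rfloor>"
    unfolding theta_prime_def by (rule floor_mono[OF theta_cone_mono[OF cl order_refl ne']])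
qed

end
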